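(* Let $n\geq 2$ be an integer, let $a_1,\ldots,a_{\ell}$ be positive integers ($\ell\geq 1$), and let $A=a_1+\cdots+a_{\ell}$. If $n\geq A$, then the 2-color Rado number of $$x_1+x_2+\cdots+x_n=a_1y_1+\cdots+a_{\ell}y_{\ell}$$ is $R_2(n+1,A)$. If $2n\geq A>n$, the same conclusion holds (the 2-color Rado number of this equation is $R_2(n+1,A)$) provided that the pair $(n,A)$ is none of $(2,3)$, $(2,4)$, $(3,5)$, $(5,10)$, $(6,11)$, $(7,12)$, $(8,13)$, $(9,14)$.
   Context: For a positive integer $r$ write $[r]=\{1,\ldots,r\}$. The 2-color Rado number of an equation is the smallest positive integer $r$ such that for every coloring of the elements of $[r]$ with two colors there exists a solution of the equation using elements of $[r]$ that are all colored the same (a monochromatic solution). The values of distinct variables in a solution are not required to be distinct. (By a theorem of Rado, this number exists for every equation $a_1x_1+\cdots+a_nx_n=b_1y_1+\cdots+b_ky_k$ with all $a_i,b_j$ positive integers, $n,k\geq 1$ and $n+k\geq 3$.) Notation: $R_2(m,a)$ denotes the 2-color Rado number of $x_1+x_2+\cdots+x_{m-1}=ax_m$; thus $R_2(n+1,A)$ is the 2-color Rado number of $x_1+\cdots+x_n=Ay$. *)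

theory Defs
  imports Main
begin

(* The lists a, b hold the coefficients of a_1 x_1 + ... + a_n x_n = b_1 y_1 + ... + b_k y_k;
   a solution is a pair of lists of values, repetitions allowed. *)
definition is_solution :: "nat list \<Rightarrow> nat list \<Rightarrow> nat list \<Rightarrow> nat list \<Rightarrow> bool" where
  "is_solution a b x y \<longleftrightarrow> length x = length a \<and> length y = length b \<and>
     (\<Sum>i<length a. a ! i * x ! i) = (\<Sum>j<length b. b ! j * y ! j)"

(* A coloring of {1..r} is represented by any extension of it to nat. *)
definition has_mono_solution :: "nat list \<Rightarrow> nat list \<Rightarrow> nat \<Rightarrow> (nat \<Rightarrow> bool) \<Rightarrow> bool" where
  "has_mono_solution a b r \<chi> \<longleftrightarrow>
     (\<exists>x y. is_solution a b x y \<and> set x \<union> set y \<subseteq> {1..r} \<and>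
        (\<exists>c. \<forall>z \<in> set x \<union> set y. \<chi> z = c))"

(* By Rado's theorem such an r exists whenever all coefficients are positive, both sides
   are nonempty and there are at least three variables; otherwise the value may be arbitrary. *)
definition rado_number2 :: "nat list \<Rightarrow> nat list \<Rightarrow> nat" where
  "rado_number2 a b = (LEAST r. 1 \<le> r \<and> (\<forall>\<chi>. has_mono_solution a b r \<chi>))"

(* x_1 + ... + x_(m-1) = a x_m; only meaningful for m at least 2. *)
definition R2 :: "nat \<Rightarrow> nat \<Rightarrow> nat" where
  "R2 m a = rado_number2 (replicate (m - 1) 1) [a]"

end

theory Submission
  imports Defs
begin

text \<open>
  Write \<open>E(a)\<close> for the equation \<open>x_1 + ... + x_n = a_1 y_1 + ... + a_l y_l\<close> and \<open>E(A)\<close> for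
  \<open>x_1 + ... + x_n = A y\<close>. Setting all \<open>y_i\<close> equal turns a solution of \<open>E(A)\<close> into one of \<open>E(a)\<close>,
  and repeating each \<open>y_i\<close> as often as \<open>a_i\<close> says turns a solution of \<open>E(a)\<close> into one of
  \<open>x_1 + ... + x_n = z_1 + ... + z_A\<close>. So it suffices to show, for each \<open>r\<close>: if some coloring of
  \<open>{1..r}\<close> has no monochromatic solution of \<open>E(A)\<close>, then some coloring of \<open>{1..r}\<close> has none of
  the last equation. Both Rado numbers are then minima of the same set, and neither has to
  be computed. For \<open>n = A\<close> the constant assignment 1 solves everything, and \<open>A = 1\<close> is trivial.

  If \<open>A \<le> 2 n\<close> and \<open>n \<le> 2 A\<close> (and \<open>n \<noteq> A \<ge> 2\<close>), the same coloring works. Short explicit solutions of \<open>E(A)\<close> inside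
  sets such as \<open>{1, 2}\<close>, \<open>{2, 4}\<close>, \<open>{1, 3, 4}\<close> force a coloring that avoids \<open>E(A)\<close> to have
  \<open>r \<le> 4\<close> and at most two numbers of each color (\<open>at_most_two_per_class\<close>); the excluded pairs
  \<open>(n, A)\<close> are those where one of these solutions is missing. In a set with at most two elements,
  either both equations or neither of them can be solved (\<open>solvable_if_at_most_two\<close>).

  If \<open>2 A < n\<close>, let \<open>c = \<lceil>n / A\<rceil> \<ge> 3\<close>. As long as \<open>A r < n c\<close>, splitting \<open>{1..r}\<close> at \<open>c\<close> avoids even
  the symmetric equation, because in each part the left-hand side exceeds the right-hand side
  (\<open>threshold_coloring_free\<close>). If \<open>A r \<ge> n c\<close>, every coloring has a monochromatic solution of
  \<open>E(A)\<close> (\<open>solvable_class_if_long\<close>). The main tool for the latter is that a class with two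
  consecutive numbers, or with a long interval, has a whole interval of \<open>n\<close>-fold sums, hence forbids
  all \<open>y\<close> in some interval; that interval then belongs to the other color, which in turn
  gets many \<open>n\<close>-fold sums. With 1 red this is played through according to the colors of
  2, 3 and 4.
\<close>

section \<open>Sums of n elements of a set\<close>

definition fold_sums :: "nat \<Rightarrow> nat set \<Rightarrow> nat set" where
  "fold_sums n S = {sum_list xs | xs. length xs = n \<and> set xs \<subseteq> S}"

definition solvable :: "nat \<Rightarrow> nat \<Rightarrow> nat set \<Rightarrow> bool" where
  "solvable n A S \<longleftrightarrow> (\<exists>y\<in>S. A * y \<in> fold_sums n S)"

definition color_class :: "nat \<Rightarrow> (nat \<Rightarrow> bool) \<Rightarrow> bool \<Rightarrow> nat set" where
  "color_class r \<chi> b = {z \<in> {1..r}. \<chi> z = b}"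

lemma fold_sums_0 [simp]: "fold_sums 0 S = {0}"
  by (auto simp: fold_sums_def)

lemma fold_sums_append:
  assumes "s \<in> fold_sums i S" "t \<in> fold_sums j S"
  shows "s + t \<in> fold_sums (i + j) S"
proof -
  obtain xs ys where "length xs = i" "set xs \<subseteq> S" "sum_list xs = s"
    "length ys = j" "set ys \<subseteq> S" "sum_list ys = t"
    using assms by (auto simp: fold_sums_def)
  then show ?thesis
    by (auto simp: fold_sums_def intro!: exI[of _ "xs @ ys"])
qed

lemma fold_sums_replicate: "u \<in> S \<Longrightarrow> n * u \<in> fold_sums n S"
  by (auto simp: fold_sums_def sum_list_replicate intro!: exI[of _ "replicate n u"])

lemma fold_sums_1: "u \<in> S \<Longrightarrow> u \<in> fold_sums (Suc 0) S"
  using fold_sums_replicate[of u S "Suc 0"] by simp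

lemma fold_sums_lower:
  assumes "s \<in> fold_sums n S" "\<And>z. z \<in> S \<Longrightarrow> l \<le> z"
  shows "n * l \<le> s"
proof -
  obtain xs where xs: "length xs = n" "set xs \<subseteq> S" "sum_list xs = s"
    using assms by (auto simp: fold_sums_def)
  have "length ys * l \<le> sum_list ys" if "set ys \<subseteq> S" for ys
    using that assms(2) by (induction ys) (auto simp: add_mono)
  with xs show ?thesis by blast
qed

lemma fold_sums_upper:
  assumes "s \<in> fold_sums n S" "\<And>z. z \<in> S \<Longrightarrow> z \<le> l"
  shows "s \<le> n * l"
proof -
  obtain xs where xs: "length xs = n" "set xs \<subseteq> S" "sum_list xs = s"
    using assms by (auto simp: fold_sums_def)
  have "sum_list ys \<le> length ys * l" if "set ys \<subseteq> S" for ys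
    using that assms(2) by (induction ys) (auto simp: add_mono)
  with xs show ?thesis by blast
qed

text \<open>
  Greedy filling: give each of the \<open>j\<close> summands \<open>a + d * i\<close> as large an index \<open>i \<le> h\<close> as the
  remaining total \<open>e\<close> of indices permits.
\<close>
lemma fold_sums_progression:
  assumes "\<And>i. i \<le> h \<Longrightarrow> a + d * i \<in> S" "e \<le> j * h"
  shows "j * a + d * e \<in> fold_sums j S"
  using assms(2)
proof (induction j arbitrary: e)
  case 0
  then show ?case by simp
next
  case (Suc j)
  define i where "i = min e h"
  have "e - i \<le> j * h" using Suc.prems by (auto simp: i_def)
  then have "j * a + d * (e - i) \<in> fold_sums j S" by (rule Suc.IH)
  moreover have "a + d * i \<in> fold_sums (Suc 0) S"
    by (rule fold_sums_1, rule assms(1)) (simp add: i_def)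
  ultimately have "(j * a + d * (e - i)) + (a + d * i) \<in> fold_sums (j + Suc 0) S"
    by (rule fold_sums_append)
  moreover have "(j * a + d * (e - i)) + (a + d * i) = Suc j * a + d * e"
  proof -
    have "d * e = d * (e - i) + d * i"
      by (metis add_mult_distrib2 i_def le_add_diff_inverse2 min.cobounded1)
    then show ?thesis by simp
  qed
  ultimately show ?case by simp
qed

text \<open>
  All solutions below have this shape: some copies of one number \<open>u\<close>, and \<open>j\<close> terms of an
  arithmetic progression, whose indices can be given any total \<open>e \<le> j * h\<close>.
\<close>
lemma solvable_progression:
  assumes "u \<in> S" "\<And>i. i \<le> h \<Longrightarrow> a + d * i \<in> S" "y \<in> S" "j \<le> n" "e \<le> j * h"
    and "A * y = (n - j) * u + (j * a + d * e)"
  shows "solvable n A S"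
proof -
  have "(n - j) * u + (j * a + d * e) \<in> fold_sums ((n - j) + j) S"
    by (intro fold_sums_append fold_sums_replicate fold_sums_progression[of h]) (use assms in auto)
  then have "A * y \<in> fold_sums n S" using assms(4,6) by simp
  with assms(3) show ?thesis unfolding solvable_def by blast
qed

lemma fold_sums_two:
  "s \<in> fold_sums n {u, u + d} \<Longrightarrow> \<exists>i\<le>n. s = n * u + d * i"
proof -
  assume "s \<in> fold_sums n {u, u + d}"
  then obtain xs where xs: "length xs = n" "set xs \<subseteq> {u, u + d}" "sum_list xs = s"
    by (auto simp: fold_sums_def)
  have "\<exists>i\<le>length ys. sum_list ys = length ys * u + d * i" if "set ys \<subseteq> {u, u + d}" for ys
    using that
  proof (induction ys)
    case (Cons y ys)
    then obtain i where i: "i \<le> length ys" "sum_list ys = length ys * u + d * i" by auto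
    show ?case
    proof (cases "y = u")
      case True
      then show ?thesis using i by (intro exI[of _ i]) auto
    next
      case False
      then have "y = u + d" using Cons.prems by auto
      then show ?thesis using i by (intro exI[of _ "Suc i"]) auto
    qed
  qed simp
  with xs show ?thesis by blast
qed

text \<open>
  Equating the two sums gives \<open>(A - n) u = d (i - j)\<close> with \<open>i \<le> n\<close> and \<open>j \<le> A\<close>. Only the difference
  \<open>i - j\<close> matters, so one can shift to \<open>j = 0\<close> (all right-hand variables equal to \<open>u\<close>) if \<open>i \<ge> j\<close>,
  and to \<open>j = A\<close> (all equal to \<open>u + d\<close>) if \<open>i \<le> j\<close> and \<open>A \<le> n\<close>.
\<close>
lemma solvable_two:
  assumes "S = {u, u + d}" "fold_sums n S \<inter> fold_sums A S \<noteq> {}"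
  shows "solvable n A S"
proof -
  obtain s where s: "s \<in> fold_sums n S" "s \<in> fold_sums A S" using assms(2) by auto
  obtain i where i: "i \<le> n" "s = n * u + d * i"
    using fold_sums_two[of s n u d] s assms(1) by auto
  obtain j where j: "j \<le> A" "s = A * u + d * j"
    using fold_sums_two[of s A u d] s assms(1) by auto
  have mem: "\<And>k. k \<le> 1 \<Longrightarrow> u + d * k \<in> S" using assms(1)
    by (auto simp: le_Suc_eq)
  have eq: "n * u + d * i = A * u + d * j" using i j by simp
  show ?thesis
  proof (cases "A \<le> n")
    case True
    define k where "k = n - A"
    have n: "n = A + k" using True by (simp add: k_def)
    have e1: "k * u + d * i = d * j" using eq n by (simp add: algebra_simps)
    show ?thesis
    proof (cases "i \<le> j")
      case True
      then obtain t where t: "j = i + t" using le_Suc_ex by blast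
      obtain v where v: "A = t + v" using t j le_Suc_ex[of t A] by auto
      have ku: "k * u = d * t" using e1 t by (simp add: algebra_simps)
      show ?thesis
        by (rule solvable_progression[of u S 1 u d "u + d" n n v])
           (use mem assms ku n v in \<open>auto simp: algebra_simps\<close>)
    next
      case False
      then obtain t where t: "i = j + t" using le_Suc_ex[of j i] by auto
      have z: "k * u = 0" "d * t = 0" using e1 t by (auto simp: algebra_simps)
      show ?thesis
        by (rule solvable_progression[of u S 1 u d u n n 0])
           (use mem assms z n in \<open>auto simp: algebra_simps\<close>)
    qed
  next
    case False
    then obtain k where A: "A = n + k" using le_Suc_ex[of n A] by auto
    have e1: "d * i = k * u + d * j" using eq A by (simp add: algebra_simps)
    show ?thesis
    proof (cases "j \<le> i")
      case True
      then obtain t where t: "i = j + t" using le_Suc_ex by blast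
      have ku: "k * u = d * t" using e1 t by (simp add: algebra_simps)
      show ?thesis
        by (rule solvable_progression[of u S 1 u d u n n t])
           (use mem assms ku A t i in \<open>auto simp: algebra_simps\<close>)
    next
      case False
      then obtain t where t: "j = i + t" using le_Suc_ex[of i j] by auto
      have z: "k * u = 0" using e1 t by (auto simp: algebra_simps)
      show ?thesis
        by (rule solvable_progression[of u S 1 u d u n n 0])
           (use mem assms z A in \<open>auto simp: algebra_simps\<close>)
    qed
  qed
qed

section \<open>Colorings and sums\<close>

lemma has_mono_solutionI:
  assumes "solvable n (sum_list a) (color_class r \<chi> b)"
  shows "has_mono_solution (replicate n 1) a r \<chi>"
proof -
  obtain y xs where y: "y \<in> color_class r \<chi> b"
    and xs: "length xs = n" "set xs \<subseteq> color_class r \<chi> b" "sum_list xs = sum_list a * y"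
    using assms by (auto simp: solvable_def fold_sums_def)
  have "(\<Sum>i<length a. a ! i * replicate (length a) y ! i) = sum_list a * y"
    by (simp add: sum_list_sum_nth sum_distrib_right atLeast0LessThan)
  moreover have "(\<Sum>i<n. replicate n 1 ! i * xs ! i) = sum_list xs"
    using xs by (simp add: sum_list_sum_nth atLeast0LessThan)
  ultimately have "is_solution (replicate n 1) a xs (replicate (length a) y)"
    using xs by (simp add: is_solution_def)
  moreover have "set xs \<union> set (replicate (length a) y) \<subseteq> color_class r \<chi> b"
    using xs y by auto
  moreover have "color_class r \<chi> b \<subseteq> {1..r}" "\<forall>z \<in> color_class r \<chi> b. \<chi> z = b"
    by (auto simp: color_class_def)
  ultimately show ?thesis
    unfolding has_mono_solution_def
    by (intro exI[of _ xs] exI[of _ "replicate (length a) y"] exI[of _ b] conjI) blast+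
qed

lemma has_mono_solutionE:
  assumes "has_mono_solution (replicate n 1) a r \<chi>"
  obtains b xs ys where "xs \<in> lists (color_class r \<chi> b)" "ys \<in> lists (color_class r \<chi> b)"
    "length xs = n" "length ys = length a" "sum_list xs = (\<Sum>i<length a. a ! i * ys ! i)"
proof -
  obtain x y b where s: "is_solution (replicate n 1) a x y" "set x \<union> set y \<subseteq> {1..r}"
    "\<forall>z \<in> set x \<union> set y. \<chi> z = b"
    using assms by (auto simp: has_mono_solution_def)
  have "sum_list x = (\<Sum>i<length a. a ! i * y ! i)"
    using s(1) by (simp add: is_solution_def sum_list_sum_nth atLeast0LessThan)
  moreover have "x \<in> lists (color_class r \<chi> b)" "y \<in> lists (color_class r \<chi> b)"
    using s by (auto simp: color_class_def)
  ultimately show ?thesis using s(1) by (intro that[of x b y]) (auto simp: is_solution_def)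
qed

lemma has_mono_solution_single_iff:
  "has_mono_solution (replicate n 1) [A] r \<chi> \<longleftrightarrow> (\<exists>b. solvable n A (color_class r \<chi> b))"
proof
  assume "has_mono_solution (replicate n 1) [A] r \<chi>"
  then obtain b xs ys where *: "xs \<in> lists (color_class r \<chi> b)" "ys \<in> lists (color_class r \<chi> b)"
    "length xs = n" "length ys = length [A]" "sum_list xs = (\<Sum>i<length [A]. [A] ! i * ys ! i)"
    by (rule has_mono_solutionE)
  then obtain y where "ys = [y]" by (auto simp: length_Suc_conv)
  then have "y \<in> color_class r \<chi> b" "A * y = sum_list xs" using * by auto
  then show "\<exists>b. solvable n A (color_class r \<chi> b)"
    using * by (auto simp: solvable_def fold_sums_def intro!: exI[of _ b] bexI[of _ y] exI[of _ xs])
next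
  assume "\<exists>b. solvable n A (color_class r \<chi> b)"
  then show "has_mono_solution (replicate n 1) [A] r \<chi>"
    using has_mono_solutionI[of n "[A]" r \<chi>] by auto
qed

text \<open>
  Each \<open>y_i\<close> is repeated \<open>a_i\<close> times. This discards the weights and keeps only their sum.
\<close>
lemma weighted_sum_in_fold_sums:
  assumes "length ys = length a" "ys \<in> lists S"
  shows "(\<Sum>i<length a. a ! i * ys ! i) \<in> fold_sums (sum_list a) S"
  using assms
proof (induction ys a rule: list_induct2)
  case (Cons y ys w a)
  have "w * y + (\<Sum>i<length a. a ! i * ys ! i) \<in> fold_sums (w + sum_list a) S"
    using Cons by (intro fold_sums_append fold_sums_replicate) auto
  then show ?case by (simp add: sum.lessThan_Suc_shift del: sum.lessThan_Suc)
qed simp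

lemma has_mono_solutionD:
  assumes "has_mono_solution (replicate n 1) a r \<chi>"
  shows "\<exists>b. fold_sums n (color_class r \<chi> b) \<inter> fold_sums (sum_list a) (color_class r \<chi> b) \<noteq> {}"
proof -
  obtain b xs ys where *: "xs \<in> lists (color_class r \<chi> b)" "ys \<in> lists (color_class r \<chi> b)"
    "length xs = n" "length ys = length a" "sum_list xs = (\<Sum>i<length a. a ! i * ys ! i)"
    using assms by (rule has_mono_solutionE)
  have "sum_list xs \<in> fold_sums n (color_class r \<chi> b)"
    unfolding fold_sums_def using *(1,3) by blast
  moreover have "sum_list xs \<in> fold_sums (sum_list a) (color_class r \<chi> b)"
    using weighted_sum_in_fold_sums[OF *(4,2)] *(5) by simp
  ultimately show ?thesis by blast
qed

section \<open>Intervals of sums\<close>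

text \<open>
  The intervals \<open>[j e, j g]\<close> and \<open>[(j + 1) e, (j + 1) g]\<close> leave no integer between them when
  \<open>g \<ge> 2 e - 1\<close>, so together they cover everything from \<open>e\<close> on.
\<close>
lemma ex_multiplier:
  fixes e g s n :: nat
  assumes "1 \<le> e" "2 * e \<le> g + 1" "e \<le> s" "s \<le> n * g"
  shows "\<exists>j\<le>n. j * e \<le> s \<and> s \<le> j * g"
proof -
  define j where "j = (LEAST j. s \<le> j * g)"
  have jg: "s \<le> j * g" and jn: "j \<le> n"
    using assms(4) unfolding j_def by (auto intro: LeastI Least_le)
  have "j * e \<le> s"
  proof (cases "j \<le> 1")
    case True
    then show ?thesis using assms(3) by (cases j) auto
  next
    case False
    then obtain i where i: "j = i + 2" using le_Suc_ex[of 2 j] by auto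
    have "\<not> s \<le> (i + 1) * g" using not_less_Least[of "i + 1" "\<lambda>j. s \<le> j * g"] i
      unfolding j_def by simp
    then have "(i + 1) * g + 1 \<le> s" by simp
    moreover have "(i + 1) * (2 * e) \<le> (i + 1) * (g + 1)" using assms(2) by (rule mult_le_mono2)
    moreover obtain f where "e = f + 1" using assms(1) le_Suc_ex[of 1 e] by auto
    ultimately show ?thesis using i by (simp add: algebra_simps)
  qed
  with jg jn show ?thesis by blast
qed

text \<open>
  The same for odd numbers only: the sum of an odd number of odd terms is odd, and consecutive
  odd multiples leave no odd number uncovered when \<open>g \<ge> 3 e - 2\<close>.
\<close>
lemma ex_odd_multiplier:
  fixes e g s n :: nat
  assumes "odd e" "odd g" "odd s" "odd n" "3 * e \<le> g + 2" "e \<le> s" "s \<le> n * g"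
  shows "\<exists>j\<le>n. odd j \<and> j * e \<le> s \<and> s \<le> j * g"
proof -
  let ?P = "\<lambda>j. odd j \<and> s \<le> j * g"
  define j where "j = (LEAST j. ?P j)"
  have "?P n" using assms by simp
  then have j: "?P j" and jn: "j \<le> n"
    unfolding j_def by (rule LeastI, rule Least_le)
  have "j * e \<le> s"
  proof (cases "j \<le> 2")
    case True
    then have "j = 1" using j by (cases "j = 0 \<or> j = 2") auto
    then show ?thesis using assms(6) by simp
  next
    case False
    then obtain i where i: "j = i + 3" using le_Suc_ex[of 3 j] by auto
    have "\<not> ?P (i + 1)" using not_less_Least[of "i + 1" ?P] i
      unfolding j_def by simp
    moreover have "odd (i + 1)" using j i by simp
    ultimately have "(i + 1) * g < s" by simp
    moreover have "odd ((i + 1) * g)" using \<open>odd (i + 1)\<close> assms(2) by simp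
    ultimately have "(i + 1) * g + 2 \<le> s" using assms(3)
      by (metis Suc_leI add_2_eq_Suc' even_Suc le_neq_implies_less)
    moreover have "(i + 1) * (3 * e) \<le> (i + 1) * (g + 2)" using assms(5) by (rule mult_le_mono2)
    moreover obtain f where "e = f + 1" using assms(1) by (cases e) auto
    ultimately show ?thesis using i by (simp add: algebra_simps)
  qed
  with j jn show ?thesis by blast
qed

text \<open>
  Replacing \<open>j\<close> of \<open>n\<close> copies of \<open>u\<close> by elements of \<open>{a..b}\<close> increases the sum \<open>n * u\<close> by any
  amount between \<open>j * (a - u)\<close> and \<open>j * (b - u)\<close>.
\<close>
lemma solvable_interval_multiplier:
  assumes "u \<in> S" "{a..b} \<subseteq> S" "u \<le> a" "a \<le> b" "y \<in> S" "j \<le> n" "n * u \<le> A * y"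
    and "j * (a - u) \<le> A * y - n * u" "A * y - n * u \<le> j * (b - u)"
  shows "solvable n A S"
proof -
  obtain e where e: "a = u + e" using assms(3) le_Suc_ex by blast
  obtain h where h: "b = a + h" using assms(4) le_Suc_ex by blast
  obtain t where t: "A * y = n * u + t" using assms(7) le_Suc_ex by blast
  obtain k where k: "n = j + k" using assms(6) le_Suc_ex by blast
  obtain v where v: "t = j * e + v" using assms(8) t e le_Suc_ex[of "j * e" t] by auto
  show ?thesis
  proof (rule solvable_progression[of u S h a 1 y j n v])
    show "v \<le> j * h" using assms(9) t v e h by (simp add: algebra_simps)
    show "A * y = (n - j) * u + (j * a + 1 * v)" using t v e k by (simp add: algebra_simps)
  qed (use assms h in auto)
qed

lemma solvable_interval:
  assumes "u \<in> S" "{a..b} \<subseteq> S" "u < a" "2 * a \<le> u + b + 1" "y \<in> S"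
    and "n * u + (a - u) \<le> A * y" "A * y \<le> n * b"
  shows "solvable n A S"
proof -
  obtain e where e: "a = u + e" "e \<ge> 1" using assms(3) less_imp_add_positive[of u a] by auto
  have ab: "a \<le> b" using assms(3,4) by simp
  obtain g where g: "b = u + g" using ab assms(3) le_Suc_ex[of u b] by auto
  have "\<exists>j\<le>n. j * e \<le> A * y - n * u \<and> A * y - n * u \<le> j * g"
    by (rule ex_multiplier) (use assms e g in \<open>auto simp: algebra_simps\<close>)
  then obtain j where "j \<le> n" "j * e \<le> A * y - n * u" "A * y - n * u \<le> j * g" by blast
  then show ?thesis
    using assms e g ab by (intro solvable_interval_multiplier[of u S a b y j]) auto
qed

section \<open>Comparable n and A\<close>

lemma solvable_1_2:
  assumes "A \<le> 2 * n" "n \<le> 2 * A" "{1, 2} \<subseteq> S"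
  shows "solvable n A S"
proof (cases "n \<le> A")
  case True
  show ?thesis
    by (rule solvable_progression[of 1 S 1 1 1 1 n n "A - n"])
       (use assms True in \<open>auto simp: le_Suc_eq numeral_2_eq_2\<close>)
next
  case False
  show ?thesis
    by (rule solvable_progression[of 1 S 1 1 1 2 n n "2 * A - n"])
       (use assms False in \<open>auto simp: le_Suc_eq numeral_2_eq_2\<close>)
qed

lemma solvable_2_4:
  assumes "A \<le> 2 * n" "n \<le> 2 * A" "{2, 4} \<subseteq> S"
  shows "solvable n A S"
proof -
  have mem: "2 + 2 * i \<in> S" if "i \<le> 1" for i
    using that assms by (cases i) auto
  show ?thesis
  proof (cases "n \<le> A")
    case True
    show ?thesis
      by (rule solvable_progression[of 2 S 1 2 2 2 n n "A - n"])
         (use assms True mem in auto)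
  next
    case False
    show ?thesis
      by (rule solvable_progression[of 2 S 1 2 2 4 n n "2 * A - n"])
         (use assms False mem in auto)
  qed
qed

lemma solvable_2_3:
  assumes "n \<le> A" "2 * A \<le> 3 * n" "{2, 3} \<subseteq> S"
  shows "solvable n A S"
proof -
  have mem: "2 + 1 * i \<in> S" if "i \<le> 1" for i
    using that assms by (cases i) auto
  show ?thesis
    by (rule solvable_progression[of 2 S 1 2 1 2 n n "2 * (A - n)"])
       (use assms mem in auto)
qed

lemma solvable_1_3_4:
  assumes "A \<le> 2 * n" "n \<le> 2 * A" "n \<noteq> A" "2 \<le> A" "2 \<le> n" "(n, A) \<noteq> (2, 3)" "{1, 3, 4} \<subseteq> S"
  shows "solvable n A S"
proof -
  have mem: "3 + 1 * i \<in> S" if "i \<le> 1" for i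
    using that assms by (cases i) auto
  have reach: "solvable n A S" if "y \<in> S" "A * y = n + t" "2 \<le> t" "t \<le> 3 * n" for y t
  proof -
    \<comment> \<open>Raising \<open>j\<close> of the ones to 3 or 4 adds \<open>t\<close> if and only if \<open>2 * j \<le> t \<le> 3 * j\<close>.\<close>
    define j where "j = (t + 2) div 3"
    have "2 * j \<le> t" "t \<le> 3 * j" "j \<le> n" using that by (auto simp: j_def)
    then show ?thesis
      by (intro solvable_progression[of 1 S 1 3 1 y j n "t - 2 * j"]) (use that assms mem in auto)
  qed
  consider "A = n + 1" | "n + 2 \<le> A" | "A < n" using assms(3) by linarith
  then show ?thesis
  proof cases
    case 1
    then show ?thesis using reach[of 3 "2 * n + 3"] assms by auto
  next
    case 2
    then show ?thesis using reach[of 1 "A - n"] assms by auto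
  next
    case 3
    then show ?thesis using reach[of 4 "4 * A - n"] assms by auto
  qed
qed

text \<open>
  For \<open>n < A\<close> and \<open>y = 1\<close> the sum has to be raised from \<open>n\<close> by \<open>A - n\<close>. The increments 3 and 4
  reach everything up to \<open>4 * n\<close> except 1, 2 and 5.
\<close>
lemma solvable_1_4_5:
  assumes "n \<le> 2 * A" "A \<le> 2 * n" "2 \<le> A" "{1, 4, 5} \<subseteq> S"
    and "n < A \<Longrightarrow> A - n \<notin> {1, 2, 5}" "n \<noteq> A"
  shows "solvable n A S"
proof -
  have mem: "4 + 1 * i \<in> S" if "i \<le> 1" for i
    using that assms by (cases i) auto
  have reach: "solvable n A S" if "y \<in> S" "A * y = n + t" "3 \<le> t" "t \<noteq> 5" "t \<le> 4 * n" for y t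
  proof -
    \<comment> \<open>Raising \<open>j\<close> of the ones to 4 or 5 adds \<open>t\<close> if and only if \<open>3 * j \<le> t \<le> 4 * j\<close>;
      the values 1, 2, 5 are never reached.\<close>
    define j where "j = (t + 3) div 4"
    define \<rho> where "\<rho> = (t + 3) mod 4"
    have t: "t + 3 = 4 * j + \<rho>" "\<rho> < 4" unfolding j_def \<rho>_def by simp_all
    have "3 * j \<le> t"
    proof (cases "3 \<le> j")
      case True
      then show ?thesis using t by linarith
    next
      case False
      then have "j = 0 \<or> j = 1 \<or> j = 2" by linarith
      then show ?thesis using t that(3,4) by (elim disjE) simp_all
    qed
    moreover have "t \<le> 4 * j" "j \<le> n" using t that(5) by simp_all
    ultimately have "3 * j \<le> t" "t \<le> 4 * j" "j \<le> n" by simp_all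
    then show ?thesis
      by (intro solvable_progression[of 1 S 1 4 1 y j n "t - 3 * j"]) (use that assms mem in auto)
  qed
  consider "n < A" | "A < n" "(n, A) = (3, 2)" | "A < n" "(n, A) \<noteq> (3, 2)" using assms(6) by linarith
  then show ?thesis
  proof cases
    case 1
    then show ?thesis using reach[of 1 "A - n"] assms by auto
  next
    case 2
    then show ?thesis using reach[of 5 7] assms by auto
  next
    case 3
    have "4 * A - n \<noteq> 5"
    proof
      assume "4 * A - n = 5"
      then have "4 * A = n + 5" by linarith
      then have "A = 2" using assms(1,3) by linarith
      then have "n = 3" using \<open>4 * A = n + 5\<close> by simp
      then show False using 3 \<open>A = 2\<close> by simp
    qed
    moreover have "3 \<le> 4 * A - n" "4 * A - n \<le> 4 * n" "A * 4 = n + (4 * A - n)"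
      using 3 assms(1,3) by linarith+
    ultimately show ?thesis using reach[of 4 "4 * A - n"] assms(4) by auto
  qed
qed

lemma solvable_2_3_5:
  assumes "A \<le> 2 * n" "n \<le> 2 * A" "2 \<le> n" "{2, 3, 5} \<subseteq> S" "n \<noteq> A"
  shows "solvable n A S"
proof -
  have mem: "3 + 2 * i \<in> S" if "i \<le> 1" for i
    using that assms by (cases i) auto
  \<comment> \<open>Raise \<open>q\<close> of the twos to 5 and \<open>\<rho>\<close> of them to 3.\<close>
  have reach: "solvable n A S" if "y \<in> S" "A * y = 2 * n + (3 * q + \<rho>)" "q + \<rho> \<le> n" for y q \<rho>
    by (rule solvable_progression[of 2 S 1 3 2 y "q + \<rho>" n q]) (use that assms mem in auto)
  show ?thesis
  proof (cases "n < A")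
    case True
    define q \<rho> where "q = 2 * (A - n) div 3" and "\<rho> = 2 * (A - n) mod 3"
    have t: "2 * (A - n) = 3 * q + \<rho>" and "\<rho> < 3" by (auto simp: q_def \<rho>_def)
    have "q + \<rho> \<le> n"
    proof (cases "\<rho> \<le> q")
      case True
      then show ?thesis using t assms(1) by linarith
    next
      case False
      moreover have "even (3 * q + \<rho>)" using t by (metis dvd_triv_left)
      moreover have "q = 1 \<Longrightarrow> \<rho> = 2" using False \<open>\<rho> < 3\<close> by linarith
      ultimately have "q = 0" using \<open>\<rho> < 3\<close> by (cases "q = 1") auto
      then show ?thesis using \<open>\<rho> < 3\<close> assms(3) by linarith
    qed
    then show ?thesis using reach[of 2 q \<rho>] t assms(4) True by auto
  next
    case False
    define q \<rho> where "q = (5 * A - 2 * n) div 3" and "\<rho> = (5 * A - 2 * n) mod 3"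
    have t: "5 * A - 2 * n = 3 * q + \<rho>" and \<rho>: "\<rho> < 3" by (auto simp: q_def \<rho>_def)
    have "5 * A = 2 * n + (3 * q + \<rho>)" using t assms(2) False by linarith
    moreover from this have "q + \<rho> \<le> n" using \<rho> assms(5) False by linarith
    ultimately show ?thesis using reach[of 5 q \<rho>] assms(4) by auto
  qed
qed

text \<open>
  With 1 red, the solvable sets force 2 to be blue, 4 red, 3 blue once 4 is present, and leave no
  color for 5. The last step needs that \<open>{1, 4, 5}\<close> or \<open>{2, 3}\<close> is solvable. This fails only if
  \<open>A - n\<close> is 1, 2 or 5 and \<open>3 * n < 2 * A\<close>, which leads to excluded pairs; the remaining excluded
  pair \<open>(2, 3)\<close> is the one where \<open>{1, 3, 4}\<close> is unsolvable.
\<close>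
lemma at_most_two_per_class:
  assumes range: "2 \<le> n" "2 \<le> A" "n \<le> 2 * A" "A \<le> 2 * n" "n \<noteq> A"
    and exc: "(n, A) \<notin> {(2, 3), (2, 4), (3, 5), (5, 10), (6, 11), (7, 12), (8, 13), (9, 14)}"
    and free: "\<And>b. \<not> solvable n A (color_class r \<chi> b)"
  shows "\<exists>u d. color_class r \<chi> b \<subseteq> {u, u + d}"
proof -
  let ?C = "color_class r \<chi>"
  have not23: "(n, A) \<noteq> (2, 3)" using exc by blast
  have in_class: "z \<in> ?C (\<chi> z)" if "1 \<le> z" "z \<le> r" for z
    using that by (simp add: color_class_def)
  have c2: "\<chi> 2 \<noteq> \<chi> 1" if "2 \<le> r"
    using solvable_1_2[OF range(4,3), of "?C (\<chi> 1)"] free in_class[of 1] in_class[of 2] that by force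
  have c4: "\<chi> 4 = \<chi> 1" if "4 \<le> r"
  proof (rule ccontr)
    assume "\<chi> 4 \<noteq> \<chi> 1"
    then have "\<chi> 4 = \<chi> 2" using c2 that by auto
    then have "{2, 4} \<subseteq> ?C (\<chi> 2)" using in_class[of 2] in_class[of 4] that by auto
    then show False using solvable_2_4[OF range(4,3)] free by blast
  qed
  have c3: "\<chi> 3 = \<chi> 2" if "4 \<le> r"
  proof (rule ccontr)
    assume "\<chi> 3 \<noteq> \<chi> 2"
    then have "\<chi> 3 = \<chi> 1" using c2 that by auto
    then have "{1, 3, 4} \<subseteq> ?C (\<chi> 1)"
      using in_class[of 1] in_class[of 3] in_class[of 4] c4 that by auto
    then show False using solvable_1_3_4[OF range(4,3,5,2,1) not23] free by blast
  qed
  have r: "r \<le> 4"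
  proof (rule ccontr)
    assume "\<not> r \<le> 4"
    then have r: "5 \<le> r" by simp
    have mem: "{2, 3} \<subseteq> ?C (\<chi> 2)" "{1, 4} \<subseteq> ?C (\<chi> 1)"
      using r in_class[of 1] in_class[of 2] in_class[of 3] in_class[of 4] c3 c4 by auto
    have "5 \<in> ?C (\<chi> 5)" using r by (intro in_class) auto
    then have "5 \<notin> ?C (\<chi> 2)" using solvable_2_3_5[OF range(4,3,1), of "?C (\<chi> 2)"] free range(5) mem by auto
    then have "\<chi> 5 = \<chi> 1" using \<open>5 \<in> ?C (\<chi> 5)\<close> c2 r by (cases "\<chi> 5 = \<chi> 2") auto
    then have "{1, 4, 5} \<subseteq> ?C (\<chi> 1)" using mem \<open>5 \<in> ?C (\<chi> 5)\<close> by auto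
    then have diff: "n < A" "A - n \<in> {1, 2, 5}"
      using solvable_1_4_5[OF range(3,4,2), of "?C (\<chi> 1)"] free range(5) by blast+
    moreover have "\<not> 2 * A \<le> 3 * n"
      using solvable_2_3[of n A "?C (\<chi> 2)"] free mem diff by auto
    ultimately have "(A = n + 2 \<and> n \<le> 3) \<or> (A = n + 5 \<and> n \<le> 9)"
      using range(1) by auto
    then show False
    proof
      assume *: "A = n + 2 \<and> n \<le> 3"
      then have "n = 2 \<or> n = 3" using range(1) by linarith
      then show False using * exc by auto
    next
      assume *: "A = n + 5 \<and> n \<le> 9"
      then have "n = 5 \<or> n = 6 \<or> n = 7 \<or> n = 8 \<or> n = 9" using range(4) by linarith
      then show False using * exc by auto
    qed
  qed
  \<comment> \<open>The class of 1 is contained in \<open>{1, 3}\<close> or \<open>{1, 4}\<close>, the other one in \<open>{2, 3}\<close>.\<close>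
  show ?thesis
  proof (cases "\<chi> 1 = b")
    case True
    have "?C b \<subseteq> {1, 1 + (if r \<le> 3 then 2 else 3)}"
    proof
      fix z assume "z \<in> ?C b"
      then have z: "1 \<le> z" "z \<le> r" "\<chi> z = \<chi> 1" using True by (auto simp: color_class_def)
      then have "z \<in> {1, 2, 3, 4}" using r by auto
      then show "z \<in> {1, 1 + (if r \<le> 3 then 2 else 3)}" using z c2 c3 r by auto
    qed
    then show ?thesis by blast
  next
    case False
    have "?C b \<subseteq> {2, 2 + 1}"
    proof
      fix z assume "z \<in> ?C b"
      then have z: "1 \<le> z" "z \<le> r" "\<chi> z \<noteq> \<chi> 1" using False by (auto simp: color_class_def)
      then have "z \<in> {1, 2, 3, 4}" using r by auto
      then show "z \<in> {2, 2 + 1}" using z c4 by auto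
    qed
    then show ?thesis by blast
  qed
qed

section \<open>More than 2 A variables on the left\<close>

lemma solvable_initial_run:
  assumes "n \<le> A * y" "A * y \<le> m * n" "1 \<le> m" "{1..m} \<subseteq> S" "y \<in> S"
  shows "solvable n A S"
proof (rule solvable_progression[of 1 S "m - 1" 1 1 y n n "A * y - n"])
  have "n * (m - 1) = m * n - n" by (simp add: algebra_simps diff_mult_distrib2)
  then show "A * y - n \<le> n * (m - 1)" using assms(2) by simp
qed (use assms in auto)

lemma solvable_2_4_evens:
  assumes "even (A * y)" "2 * n \<le> A * y" "A * y \<le> 4 * n" "{2, 4, y} \<subseteq> S"
  shows "solvable n A S"
proof (rule solvable_progression[of 2 S 1 2 2 y n n "(A * y - 2 * n) div 2"])
  show "2 + 2 * i \<in> S" if "i \<le> 1" for i using that assms(4) by (cases i) auto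
qed (use assms in auto)

lemma solvable_1_3_same_parity:
  assumes "even (A * y) = even n" "n \<le> A * y" "A * y \<le> 3 * n" "{1, 3, y} \<subseteq> S"
  shows "solvable n A S"
proof (rule solvable_progression[of 1 S 1 1 2 y n n "(A * y - n) div 2"])
  show "1 + 2 * i \<in> S" if "i \<le> 1" for i
    using that assms(4) by (cases i) (auto simp: numeral_3_eq_3)
  have "even (A * y - n)" using assms(1,2) by simp
  then show "A * y = (n - n) * 1 + (n * 1 + 2 * ((A * y - n) div 2))" using assms(2) by simp
qed (use assms in auto)

text \<open>
  The \<open>n\<close>-fold sums of \<open>{1, 3, 4}\<close> between \<open>n\<close> and \<open>3 * n\<close> omit only \<open>n + 1\<close>: raise half of
  the excess many ones to 3, and one of these to 4 if the excess is odd.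
\<close>
lemma solvable_1_3_4_sums:
  assumes "n + 2 \<le> A * y" "A * y \<le> 3 * n" "{1, 3, 4, y} \<subseteq> S"
  shows "solvable n A S"
proof -
  define t where "t = A * y - n"
  have mem: "3 + 1 * i \<in> S" if "i \<le> 1" for i using that assms(3) by (cases i) auto
  have "t mod 2 \<le> t div 2 * 1" "t div 2 \<le> n" "A * y = n + (2 * (t div 2) + t mod 2)"
    using assms unfolding t_def by auto
  then show ?thesis using mem assms(3)
    by (intro solvable_progression[of 1 S 1 3 1 y "t div 2" n "t mod 2"]) auto
qed

text \<open>
  Here \<open>P + 1\<close> and \<open>Q + 1\<close> are the least and the greatest \<open>y\<close> with \<open>2 * n \<le> A * y \<le> 3 * n\<close>. To solve
  the equation with \<open>y = Q + 1\<close>, replace \<open>A - k\<close> of \<open>n\<close> ones by numbers from \<open>{P + 1..Q + 1}\<close>; this works if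
  and only if \<open>(A - k) * P \<le> A * Q - (n - A) \<le> (A - k) * Q\<close>, which is the condition on \<open>k\<close>. The
  greatest \<open>k\<close> with \<open>k * Q \<le> n - A\<close> is \<open>(n - A) div Q\<close>. Since \<open>Q - P\<close> is positive and more than
  \<open>n / A - 2\<close>, it satisfies the other inequality if \<open>A \<ge> 10\<close>; for \<open>A < 10\<close> the rounding of \<open>P\<close> and \<open>Q\<close> matters, and
  \<open>k = 0\<close> or \<open>k = 1\<close> is enough.
\<close>
lemma ex_balanced_multiplicity:
  fixes A n P Q :: nat
  assumes "2 \<le> A" "2 * A < n"
    and P: "2 * n \<le> A * (P + 1)" "A * P < 2 * n"
    and Q: "A * (Q + 1) \<le> 3 * n" "3 * n < A * (Q + 2)"
  shows "P < Q" "\<exists>k\<le>A. k * Q \<le> n - A \<and> n - A \<le> A * (Q - P) + k * P"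
proof -
  have "A * P + (n + 1) < A * Q + 2 * A + 1" using P(2) Q(2) by (simp add: algebra_simps)
  then have "A * P < A * Q" using assms(2) by linarith
  then show PQ: "P < Q" by simp
  define g where "g = Q - P"
  have g: "Q = P + g" "1 \<le> g" using PQ by (auto simp: g_def)
  have "A * (3 * P) < A * (2 * (P + g + 2))" using P(2) Q(2) g by (simp add: algebra_simps)
  then have "3 * P < 2 * (P + g + 2)" by (simp only: mult_less_cancel1)
  then have Pg: "P \<le> 2 * g + 3" by simp
  show "\<exists>k\<le>A. k * Q \<le> n - A \<and> n - A \<le> A * (Q - P) + k * P"
  proof (cases "A < 10")
    case True
    consider "A = 2" | "A = 3" | "A \<in> {4, 5, 6, 7, 8, 9}" using True assms(1) by fastforce
    then show ?thesis
    proof cases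
      case 1
      then show ?thesis using assms g by (intro exI[of _ 0]) auto
    next
      case 2
      then have "Q + 1 = n" using Q by simp
      then show ?thesis using 2 P g by (intro exI[of _ 0]) auto
    next
      case 3
      then have "Q \<le> n - A" using assms(2) Q(1) by (elim insertE) auto
      moreover have "n - A \<le> A * g + P"
      proof -
        obtain C where C: "A = C + 3" "C \<le> 6" using 3 le_Suc_ex[of 3 A] by auto
        have "C * P \<le> C * (2 * g + 3)" using Pg by (rule mult_le_mono2)
        then have "3 * n < 3 * (A + A * g + P + 1)"
          using Q(2) g C by (simp add: algebra_simps)
        then have "n < A + A * g + P + 1" by (simp only: mult_less_cancel1)
        then show ?thesis by linarith
      qed
      ultimately show ?thesis using assms(1) g by (intro exI[of _ 1]) auto
    qed
  next
    case False
    then obtain B where A: "A = B + 10" using le_Suc_ex[of 10 A] by auto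
    define D where "D = n - A"
    define k where "k = D div Q"
    define \<rho> where "\<rho> = D mod Q"
    have n: "n = A + D" "A < D" using assms(2) by (auto simp: D_def)
    have Q0: "0 < Q" using PQ by simp
    have D: "D = k * Q + \<rho>" "\<rho> < Q" using Q0 by (auto simp: k_def \<rho>_def)
    \<comment> \<open>It remains to show \<open>\<rho> \<le> (A - k) * g\<close>, where at least two thirds of the \<open>A\<close> copies are left.\<close>
    have "3 * k \<le> A"
    proof (rule ccontr)
      assume "\<not> 3 * k \<le> A"
      then have "A + 1 \<le> 3 * k" by simp
      then have "(A + 1) * (A * Q) \<le> 3 * k * (A * Q)" by (rule mult_le_mono1)
      also have "\<dots> = 3 * A * (k * Q)" by simp
      also have "\<dots> \<le> 3 * A * D" using D by simp
      finally have 1: "(A + 1) * (A * Q) \<le> 3 * A * D" .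
      have "A + 3 * D + 1 \<le> A * Q" using Q(2) n by (simp add: algebra_simps)
      then have "(A + 1) * (A + 3 * D + 1) \<le> (A + 1) * (A * Q)" by (rule mult_le_mono2)
      with 1 show False by (simp add: algebra_simps)
    qed
    \<comment> \<open>For small \<open>n\<close> the bound \<open>g \<ge> 1\<close> is enough; for large \<open>n\<close> use \<open>A * g \<ge> n - 2 * A + 2\<close>.
      The threshold is where \<open>g = 1\<close> stops being sufficient, and \<open>A \<ge> 10\<close> makes the two ranges meet.\<close>
    have "3 * (Q - 1) \<le> 2 * A * g"
    proof (cases "9 * n \<le> 2 * A * A + 6 * A")
      case True
      have "3 * (A * (Q + 1)) \<le> 2 * A * A + 6 * A" using Q(1) True by linarith
      also have "\<dots> = A * (2 * A + 6)" by (simp add: algebra_simps)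
      finally have "A * (3 * (Q + 1)) \<le> A * (2 * A + 6)" by (simp add: algebra_simps)
      then have "3 * (Q + 1) \<le> 2 * A + 6" using A by (simp only: mult_le_cancel1)
      then have "3 * (Q - 1) \<le> 2 * A" by (cases Q) simp_all
      also have "\<dots> \<le> 2 * A * g" using g by simp
      finally show ?thesis .
    next
      case False
      have Ag: "2 * n + 4 \<le> 2 * A * g + 4 * A"
        using P(2) Q(2) g by (simp add: algebra_simps)
      have 1: "A * (2 * n + 4) \<le> A * (2 * A * g + 4 * A)" using Ag by (rule mult_le_mono2)
      have 2: "3 * (A * Q) + 3 * A \<le> 9 * n" using Q(1) by simp
      have "(2 * B + 11) * (2 * A * A + 6 * A) \<le> (2 * B + 11) * (9 * n)"
        using False by (intro mult_le_mono2) simp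
      then have 3: "4 * (A * A) + 9 * n \<le> A * (2 * n + 4) + 6 * A"
        unfolding A by (simp add: algebra_simps)
      have "3 * (A * Q) \<le> A * (2 * A * g) + 3 * A"
        using 1 2 3 by (simp add: algebra_simps)
      then have "A * (3 * Q) \<le> A * (2 * A * g + 3)" by (simp add: algebra_simps)
      then have "3 * Q \<le> 2 * A * g + 3" using A by (simp only: mult_le_cancel1)
      then show ?thesis by simp
    qed
    have "3 * \<rho> \<le> 2 * A * g" using \<open>3 * (Q - 1) \<le> 2 * A * g\<close> D(2) by linarith
    then have "3 * \<rho> \<le> 2 * (A * g)" by (simp only: mult.assoc)
    moreover have "3 * (k * g) \<le> A * g"
      using mult_le_mono1[OF \<open>3 * k \<le> A\<close>, of g] by (simp only: mult.assoc)
    ultimately have "k * g + \<rho> \<le> A * g" by linarith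
    then have "D \<le> A * g + k * P" using D(1) g(1) by (simp add: algebra_simps)
    then show ?thesis using D \<open>3 * k \<le> A\<close> g(1) D_def by (intro exI[of _ k]) auto
  qed
qed

lemma solvable_1_interval:
  assumes "2 \<le> A" "2 * A < n" "1 \<in> S"
    and I: "\<And>y. 2 * n \<le> A * y \<Longrightarrow> A * y \<le> 3 * n \<Longrightarrow> y \<in> S"
  shows "solvable n A S"
proof -
  define P Q where "P = (2 * n - 1) div A" and "Q = 3 * n div A - 1"
  have A: "0 < A" using assms(1) by simp
  have "2 * n - 1 = A * P + (2 * n - 1) mod A" "(2 * n - 1) mod A < A"
    using A by (auto simp: P_def)
  then have P: "2 * n \<le> A * (P + 1)" "A * P < 2 * n" using assms(2) by (auto simp: algebra_simps)
  have "1 \<le> 3 * n div A" using assms(1,2) A by (simp add: div_greater_zero_iff Suc_le_eq)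
  then have Q1: "Q + 1 = 3 * n div A" by (simp add: Q_def)
  have "A * (Q + 1) + 3 * n mod A = 3 * n" "3 * n mod A < A" using A unfolding Q1 by simp_all
  then have Q: "A * (Q + 1) \<le> 3 * n" "3 * n < A * (Q + 2)"
    by (simp_all add: algebra_simps)
  obtain k where k: "P < Q" "k \<le> A" "k * Q \<le> n - A" "n - A \<le> A * (Q - P) + k * P"
    using ex_balanced_multiplicity[OF assms(1,2) P Q] by blast
  obtain g where g: "Q = P + g" using k(1) less_imp_add_positive by blast
  obtain D where D: "n = A + D" using assms(2) le_Suc_ex[of A n] by auto
  obtain v where v: "A = k + v" using k(2) le_Suc_ex by blast
  have sub: "{P + 1..Q + 1} \<subseteq> S"
  proof
    fix y assume "y \<in> {P + 1..Q + 1}"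
    then have "A * (P + 1) \<le> A * y" "A * y \<le> A * (Q + 1)" by (intro mult_le_mono2; simp)+
    then show "y \<in> S" using P(1) Q(1) by (intro I) linarith+
  qed
  have "n \<le> A * (Q + 1)" using Q(2) assms(2) by (simp add: algebra_simps)
  moreover have "v * P + D \<le> A * Q" using k(4) D g v by (simp add: algebra_simps)
  moreover have "A * Q \<le> v * Q + D" using k(3) D v by (simp add: algebra_simps)
  ultimately show ?thesis
    by (intro solvable_interval_multiplier[of 1 S "P + 1" "Q + 1" "Q + 1" v])
       (use assms(3) sub k(1) v D in \<open>auto simp: algebra_simps\<close>)
qed

lemma three_le_ceiling:
  fixes A n c :: nat
  assumes "2 * A < n" "(c - 1) * A < n" "n \<le> c * A" "2 \<le> A"
  shows "3 \<le> c"
proof (rule ccontr)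
  assume "\<not> 3 \<le> c"
  then have "c * A \<le> 2 * A" by (intro mult_le_mono1) simp
  with assms show False by simp
qed

lemma floor_multiple:
  fixes A N :: nat
  assumes "0 < A"
  shows "A * (N div A) \<le> N" "N < A * (N div A + 1)"
  using assms by (auto simp: dividend_less_times_div)

lemma ceil_multiple:
  fixes A N :: nat
  assumes "0 < A"
  shows "N \<le> A * ((N + A - 1) div A)" "A * ((N + A - 1) div A) < N + A"
proof -
  have "N + A - 1 < A * ((N + A - 1) div A) + A"
    using floor_multiple(2)[OF assms, of "N + A - 1"] by simp
  then show "N \<le> A * ((N + A - 1) div A)" using assms by linarith
  show "A * ((N + A - 1) div A) < N + A"
    using floor_multiple(1)[OF assms, of "N + A - 1"] assms by linarith
qed

lemma le_if_scaled_le: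
  fixes A y r N :: nat
  assumes "A * y \<le> N" "N \<le> A * r" "0 < A"
  shows "y \<le> r"
  using assms by (meson le_trans nat_mult_le_cancel1)

text \<open>
  A coloring of \<open>{1..r}\<close> without monochromatic solution, where \<open>A * r \<ge> n * c\<close> and 1 is red
  (in \<open>R\<close>), to be refuted. The conditions on \<open>c\<close> say that \<open>c = \<lceil>n / A\<rceil>\<close>.
\<close>
locale free_two_coloring =
  fixes n A c r :: nat and R B :: "nat set"
  assumes A2: "2 \<le> A" and nA: "2 * A < n"
    and c: "(c - 1) * A < n" "n \<le> c * A"
    and r: "n * c \<le> A * r"
    and cover: "\<And>y. 1 \<le> y \<Longrightarrow> y \<le> r \<Longrightarrow> y \<in> R \<or> y \<in> B"
    and free: "\<not> solvable n A R" "\<not> solvable n A B"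
    and R1: "1 \<in> R"
begin

lemma c3: "3 \<le> c"
  using three_le_ceiling nA c A2 by blast

lemma n_le: "n \<le> A * c"
  using c(2) by (simp add: mult.commute)

lemma mn_le:
  assumes "m \<le> c" "A * y \<le> m * n"
  shows "y \<le> r"
proof -
  have "m * n \<le> c * n" using assms(1) by (rule mult_le_mono1)
  then have "A * y \<le> c * n" using assms(2) by linarith
  moreover have "c * n \<le> A * r" using r by (simp add: mult.commute)
  ultimately show ?thesis using A2 by (intro le_if_scaled_le[of A y "c * n" r]) auto
qed

lemma c_le: "c + A \<le> n"
proof -
  obtain b where b: "c = b + 3" using c3 le_Suc_ex[of 3 c] by auto
  have "b * 1 \<le> b * A" using A2 by (intro mult_le_mono2) simp
  moreover have "b * A + 2 * A < n" using c(1) b by (simp add: algebra_simps)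
  ultimately show ?thesis using A2 unfolding b by linarith
qed

text \<open>
  Suppose \<open>{1..m}\<close> with \<open>m \<ge> 2\<close> is the longest red initial run. Its \<open>n\<close>-fold sums fill \<open>[n, m n]\<close>, so
  every \<open>y\<close> from \<open>c\<close> to \<open>m n div A\<close> is blue, and so is \<open>m + 1\<close>. Hence blue \<open>n\<close>-fold sums fill an
  interval that starts shortly after \<open>(m + 1) n\<close> (just there, if \<open>m + 1 = c\<close>). A suitable \<open>y \<le> r\<close> beyond
  \<open>(m + 1) n / A\<close> can therefore not be blue. It cannot be red either, since \<open>A y\<close> is the sum of \<open>A - k\<close> copies
  of \<open>y\<close> and \<open>n - A + k\<close> numbers from \<open>{1..m}\<close> as soon as \<open>k y\<close> lies between \<open>n - A + k\<close> and
  \<open>m (n - A + k)\<close>.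
\<close>
lemma two_not_in_R: "2 \<notin> R"
proof
  assume "2 \<in> R"
  define D where "D = n - A"
  have n: "n = A + D" "A < D" using nA by (auto simp: D_def)
  define s where "s = (LEAST m. 1 \<le> m \<and> m \<notin> R)"
  define f where "f = (n * c + A - 1) div A"
  have f: "n * c \<le> A * f" "A * f < n * c + A"
    using ceil_multiple[of A "n * c"] A2 unfolding f_def by auto
  have fr: "f \<le> r"
  proof -
    have "A * f < A * (r + 1)" using f(2) r by (simp add: algebra_simps)
    then have "f < r + 1" by (simp only: mult_less_cancel1)
    then show ?thesis by simp
  qed
  have blue: "y \<in> B" if "n \<le> A * y" "A * y \<le> m * n" "{1..m} \<subseteq> R" "1 \<le> m" "m \<le> c" for m y
  proof -
    have "y \<noteq> 0" using that(1) nA by (cases y) auto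
    then have "y \<in> R \<or> y \<in> B" using mn_le[OF that(5,2)] by (intro cover) auto
    moreover have "y \<notin> R" using solvable_initial_run[of n A y m R] that free nA by auto
    ultimately show ?thesis by blast
  qed
  have "c \<notin> R"
  proof -
    have "c * A < 2 * n" using c(1) nA c3
      by (cases c) (auto simp: algebra_simps)
    moreover have "{1..2} \<subseteq> R" using R1 \<open>2 \<in> R\<close> by (auto simp: le_Suc_eq numeral_2_eq_2)
    ultimately show ?thesis
      using solvable_initial_run[of n A c 2 R] c free nA by (auto simp: mult.commute)
  qed
  then have "1 \<le> c \<and> c \<notin> R" using c3 by simp
  then have s: "1 \<le> s" "s \<notin> R" "s \<le> c"
    unfolding s_def by (metis (mono_tags, lifting) LeastI, metis (mono_tags, lifting) LeastI, metis (mono_tags, lifting) Least_le)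
  define m where "m = s - 1"
  have "s \<noteq> 1" "s \<noteq> 2" using s R1 \<open>2 \<in> R\<close> by auto
  then have m: "s = m + 1" "2 \<le> m" using s(1) by (auto simp: m_def)
  have run: "{1..m} \<subseteq> R"
  proof
    fix z assume "z \<in> {1..m}"
    then have "z < s" "1 \<le> z" using m by auto
    then show "z \<in> R" unfolding s_def using not_less_Least by blast
  qed
  have "c \<le> r" using mn_le[of 2 c] c nA c3 by (cases c) (auto simp: algebra_simps)
  then have uB: "m + 1 \<in> B" using cover[of "m + 1"] s m by auto
  define W where "W = m * n div A"
  have W: "A * W \<le> m * n" "m * n < A * (W + 1)" using floor_multiple[of A "m * n"] A2 by (auto simp: W_def)
  have WB: "{c..W} \<subseteq> B"
  proof
    fix y assume "y \<in> {c..W}"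
    then have "A * c \<le> A * y" "A * y \<le> A * W" by (intro mult_le_mono2; simp)+
    then have "n \<le> A * y" "A * y \<le> m * n" using n_le W(1) by linarith+
    then show "y \<in> B" using blue[of y m] run m s(3) by simp
  qed
  have W2: "2 * (c - 1) \<le> W"
  proof -
    have "A * (2 * (c - 1)) < 2 * n" using c(1) by (simp add: algebra_simps)
    also have "\<dots> \<le> m * n" using m(2) by (rule mult_le_mono1)
    also have "\<dots> < A * (W + 1)" by (rule W)
    finally have "2 * (c - 1) < W + 1" by (simp only: mult_less_cancel1)
    then show ?thesis by simp
  qed
  \<comment> \<open>\<open>f\<close> is the ceiling of \<open>n * c / A\<close>. The value \<open>m * (D + 1)\<close> is the greatest one with a red
    solution for \<open>k = 1\<close>; if \<open>f\<close> is smaller, then \<open>f\<close> has one for a suitable \<open>k\<close>.\<close>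
  define y where "y = min f (m * (D + 1))"
  have y_pos: "1 \<le> y"
  proof -
    have "f \<noteq> 0" using f(1) nA c3 by (cases f) auto
    then show ?thesis using m by (auto simp: y_def)
  qed
  have y_lower: "(m + 1) * n + (c - (m + 1)) \<le> A * y"
  proof -
    have cn: "c \<le> D" using c_le n by simp
    have "(m + 1) * n + (c - (m + 1)) \<le> A * f"
    proof (cases "m + 1 = c")
      case True
      then show ?thesis using f(1) by (simp add: mult.commute)
    next
      case False
      then obtain q where "c = m + 2 + q" using s(3) m le_Suc_ex[of "m + 2" c] by auto
      moreover have "c \<le> n" using cn n by simp
      ultimately show ?thesis using f(1) by (simp add: algebra_simps)
    qed
    moreover have "(m + 1) * n + (c - (m + 1)) \<le> A * (m * (D + 1))"
    proof -
      obtain m' where m': "m = m' + 2" using m(2) le_Suc_ex[of 2 m] by auto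
      obtain A' where A': "A = A' + 2" using A2 le_Suc_ex[of 2 A] by auto
      obtain D' where D': "D = D' + 1" using n(2) le_Suc_ex[of 1 D] by auto
      have "c - (m + 1) + 3 \<le> c" using m(2) s(3) c3 m(1) by simp
      then show ?thesis using cn n unfolding m' A' D' by (simp add: algebra_simps)
    qed
    ultimately show ?thesis by (simp add: y_def min_def)
  qed
  have y_upper: "A * y \<le> n * W"
  proof -
    have "A * y \<le> A * f" by (simp add: y_def)
    also have "\<dots> \<le> n * c + n" using f(2) nA by simp
    also have "\<dots> = n * (c + 1)" by simp
    also have "\<dots> \<le> n * W" using W2 c3 by (intro mult_le_mono2) simp
    finally show ?thesis .
  qed
  have "y \<notin> B"
  proof
    assume "y \<in> B"
    have "solvable n A B"
    proof (cases "m + 1 = c")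
      case False
      then show ?thesis
        using solvable_interval[of "m + 1" B c W y n A] uB WB \<open>y \<in> B\<close> s(3) m W2 c3 y_lower y_upper
        by (simp add: mult.commute)
    next
      case True
      obtain t where t: "A * y = n * (m + 1) + t" using y_lower le_Suc_ex[of "n * (m + 1)" "A * y"]
        by (auto simp: mult.commute)
      have tn: "t \<le> n * (W - (m + 1))" using y_upper t by (simp add: diff_mult_distrib2)
      show ?thesis
        by (rule solvable_progression[of "m + 1" B "W - (m + 1)" "m + 1" 1 y n n t])
           (use uB WB True W2 c3 t tn \<open>y \<in> B\<close> in auto)
    qed
    then show False using free by simp
  qed
  moreover have "y \<notin> R"
  proof
    assume "y \<in> R"
    have "\<exists>k\<le>A. D + k \<le> k * y \<and> k * y \<le> m * (D + k)"
    proof (cases "m * (D + 1) \<le> f")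
      case True
      then have "y = m * (D + 1)" by (simp add: y_def)
      moreover have "D + 1 \<le> m * (D + 1)" using m by (cases m) auto
      ultimately show ?thesis using A2 by (intro exI[of _ 1]) auto
    next
      case False
      then have y: "y = f" and f_less: "f < m * (D + 1)" by (auto simp: y_def)
      have f_big: "n \<le> A * (f - 1)"
      proof -
        have "n * 3 \<le> n * c" using c3 by (rule mult_le_mono2)
        then have "n + A \<le> A * f" using f(1) nA by linarith
        then show ?thesis by (simp add: diff_mult_distrib2)
      qed
      define g where "g = f - 1"
      have "g \<noteq> 0"
      proof
        assume "g = 0"
        then have "A * (f - 1) = 0" by (simp add: g_def)
        then show False using f_big nA by linarith
      qed
      then have g: "f = g + 1" "0 < g" by (auto simp: g_def)
      \<comment> \<open>The least \<open>k\<close> with \<open>D + k \<le> k * f\<close>. Rounding up costs less than a factor 2 if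
        \<open>D > g\<close>, which \<open>m \<ge> 2\<close> absorbs.\<close>
      define k where "k = (D + g - 1) div g"
      have k: "D \<le> k * g" "k * g < D + g"
        using ceil_multiple[of g D] g(2) unfolding k_def by (auto simp: mult.commute)
      have "k * g < (A + 1) * g" using k(2) f_big n by (simp add: g_def algebra_simps)
      then have "k \<le> A" by (simp only: mult_less_cancel2) simp
      moreover have "k * f \<le> m * (D + k)"
      proof (cases "D \<le> g")
        case True
        then have "k * g < 2 * g" using k(2) by linarith
        then have "k < 2" by (simp only: mult_less_cancel2)
        moreover have "k \<noteq> 0" using k(1) n by (cases k) auto
        ultimately have "k = 1" by simp
        then show ?thesis using f_less by simp
      next
        case False
        have "k * f = k * g + k" using g by simp
        also have "\<dots> \<le> 2 * (D + k)" using k(2) False by simp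
        also have "\<dots> \<le> m * (D + k)" using m(2) by (rule mult_le_mono1)
        finally show ?thesis .
      qed
      moreover have "D + k \<le> k * f" using k(1) g by simp
      ultimately show ?thesis using y by blast
    qed
    then obtain k where k: "k \<le> A" "D + k \<le> k * y" "k * y \<le> m * (D + k)" by blast
    obtain v where v: "A = k + v" using k(1) le_Suc_ex by blast
    obtain e where e: "k * y = D + k + e" using k(2) le_Suc_ex by blast
    obtain m' where m': "m = m' + 1" using m(2) le_Suc_ex[of 1 m] by auto
    have "solvable n A R"
    proof (rule solvable_progression[of y R "m - 1" 1 1 y "D + k" n e])
      show "e \<le> (D + k) * (m - 1)" using k(3) e unfolding m' by (simp add: algebra_simps)
      show "A * y = (n - (D + k)) * y + ((D + k) * 1 + 1 * e)"
        using e v n by (simp add: algebra_simps)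
    qed (use \<open>y \<in> R\<close> run m k n in auto)
    then show False using free by simp
  qed
  moreover have "y \<in> R \<or> y \<in> B" using y_pos fr by (intro cover) (auto simp: y_def)
  ultimately show False by blast
qed

text \<open>
  By \<open>solvable_1_interval\<close>, some \<open>y0\<close> with \<open>2 n \<le> A y0 \<le> 3 n\<close> is blue. If 3 were blue, then \<open>A y0\<close> would be a
  sum of \<open>n\<close> twos and threes. If 4 were blue, then \<open>{2, 4}\<close> would make red every \<open>y\<close> in this range with
  \<open>A y\<close> even, while \<open>{1, 3}\<close> makes blue every \<open>y\<close> with \<open>n \<le> A y \<le> 3 n\<close> and \<open>A y \<equiv> n (mod 2)\<close>. This is
  contradictory unless \<open>A\<close> and \<open>n\<close> are both odd; then 2 together with the blue odd numbers from \<open>c\<close>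
  to \<open>3 n / A\<close> solves the equation.
\<close>
lemma two_in_B: "2 \<in> B"
  and three_in_R: "3 \<in> R"
  and four_in_R: "4 \<in> R"
proof -
  have "4 \<le> r" using mn_le[of 2 4] nA c3 by simp
  then have cov: "2 \<in> R \<or> 2 \<in> B" "3 \<in> R \<or> 3 \<in> B" "4 \<in> R \<or> 4 \<in> B"
    using cover by simp_all
  show B2: "2 \<in> B" using cov two_not_in_R by blast
  have in_RB: "y \<in> R \<or> y \<in> B" if "n \<le> A * y" "A * y \<le> 3 * n" for y
  proof -
    have "y \<noteq> 0" using that(1) nA by (cases y) auto
    then show ?thesis using mn_le[OF c3 that(2)] by (intro cover) auto
  qed
  obtain y0 where y0: "2 * n \<le> A * y0" "A * y0 \<le> 3 * n" "y0 \<notin> R"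
    using solvable_1_interval[OF A2 nA R1] free by blast
  then have y0B: "y0 \<in> B" using in_RB[of y0] by simp
  show R3: "3 \<in> R"
  proof (rule ccontr)
    assume "3 \<notin> R"
    then have mem: "2 + 1 * i \<in> B" if "i \<le> 1" for i
      using that B2 cov by (cases i) auto
    have "solvable n A B"
      by (rule solvable_progression[of 2 B 1 2 1 y0 n n "A * y0 - 2 * n"])
         (use mem B2 y0 y0B in auto)
    then show False using free by simp
  qed
  show "4 \<in> R"
  proof (rule ccontr)
    assume "4 \<notin> R"
    then have B4: "4 \<in> B" using cov by blast
    have even_R: "y \<in> R" if "even (A * y)" "2 * n \<le> A * y" "A * y \<le> 3 * n" for y
      using solvable_2_4_evens[of A y n B] in_RB[of y] free B2 B4 that by auto
    have parity_B: "y \<in> B" if "even (A * y) = even n" "n \<le> A * y" "A * y \<le> 3 * n" for y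
      using solvable_1_3_same_parity[of A y n R] in_RB[of y] free R1 R3 that by auto
    have both: False if "y \<in> R" "y \<in> B" "even (A * y)" "2 * n \<le> A * y" "A * y \<le> 3 * n" for y
      using solvable_2_4_evens[of A y n B] free B2 B4 that by auto
    consider "even A" | "odd A" "even n" | "odd A" "odd n" by blast
    then show False
    proof cases
      case 1
      then show False using even_R[of y0] y0 by simp
    next
      case 2
      define p where "p = (2 * n + A - 1) div A"
      have p: "2 * n \<le> A * p" "A * p < 2 * n + A"
        using ceil_multiple[of A "2 * n"] A2 unfolding p_def by auto
      define y where "y = (if even p then p else p + 1)"
      have "2 * n \<le> A * y" "A * y \<le> 3 * n" "even y"
        using p nA by (auto simp: y_def algebra_simps)
      then show False using both[of y] even_R[of y] parity_B[of y] 2 by simp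
    next
      case 3
      \<comment> \<open>All odd numbers from \<open>a\<close> to \<open>b\<close> are blue. Solve with \<open>y = b\<close>, raising an odd number \<open>j\<close> of the twos
        to such numbers.\<close>
      define q where "q = 3 * n div A"
      have q: "A * q \<le> 3 * n" "3 * n < A * (q + 1)"
        using floor_multiple[of A "3 * n"] A2 unfolding q_def by auto
      have "A * (3 * c - 3) < A * (q + 1)"
        using c(1) q(2) by (simp add: algebra_simps)
      then have qc: "3 * c - 3 < q + 1" by (simp only: mult_less_cancel1)
      define a where "a = (if odd c then c else c + 1)"
      define b where "b = (if odd q then q else q - 1)"
      have ac: "c \<le> a" "a \<le> c + 1" "odd a" by (auto simp: a_def)
      have bq: "b \<le> q" "q \<le> b + 1" "odd b" using qc c3 by (auto simp: b_def)
      have ab: "3 * a \<le> b + 6"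
      proof (cases "odd c")
        case True
        then show ?thesis using qc bq(2) by (simp add: a_def)
      next
        case False
        then have "odd (3 * c - 3)" using c3 by simp
        then have "3 * c - 3 \<le> b" using qc bq False by (cases "q = 3 * c - 3") (auto simp: b_def)
        then show ?thesis using False by (simp add: a_def)
      qed
      have "a \<le> b" using ab ac c3 qc bq by linarith
      moreover have "even (b - a)" using ac bq by simp
      ultimately obtain h where h: "b = a + 2 * h"
        by (metis evenE le_add_diff_inverse)
      have Aa: "n \<le> A * a"
      proof -
        have "A * c \<le> A * a" using ac(1) by (rule mult_le_mono2)
        then show ?thesis using n_le by linarith
      qed
      have Ab: "A * b \<le> 3 * n" "3 * n < A * b + 2 * A"
      proof -
        have "A * b \<le> A * q" using bq(1) by (rule mult_le_mono2)
        then show "A * b \<le> 3 * n" using q(1) by linarith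
        have "A * (q + 1) \<le> A * (b + 2)" using bq(2) by (intro mult_le_mono2) simp
        then show "3 * n < A * b + 2 * A" using q(2) by (simp add: algebra_simps)
      qed
      have mem: "a + 2 * i \<in> B" if "i \<le> h" for i
      proof -
        have "A * a \<le> A * (a + 2 * i)" "A * (a + 2 * i) \<le> A * b" using that h
          by (intro mult_le_mono2; simp)+
        then have "n \<le> A * (a + 2 * i)" "A * (a + 2 * i) \<le> 3 * n" using Aa Ab(1) by linarith+
        then show ?thesis using parity_B[of "a + 2 * i"] 3 ac(3) by simp
      qed
      define s where "s = A * b - 2 * n"
      have s: "A * b = 2 * n + s" using Ab nA by (auto simp: s_def)
      have cA: "c + 2 * A \<le> n + 2"
      proof -
        obtain d where d: "c = d + 3" using c3 le_Suc_ex[of 3 c] by auto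
        have "d * 1 \<le> d * A" using A2 by (intro mult_le_mono2) simp
        moreover have "d * A + 2 * A < n" using c(1) d by (simp add: algebra_simps)
        ultimately show ?thesis unfolding d by linarith
      qed
      obtain e where e: "a = e + 2" using ac c3 le_Suc_ex[of 2 a] by auto
      have "\<exists>j\<le>A. odd j \<and> j * e \<le> s \<and> s \<le> j * (b - 2)"
      proof (rule ex_odd_multiplier)
        show "odd e" using ac(3) e by simp
        show "odd (b - 2)" using bq(3) h e by simp
        show "odd s" using s bq(3) 3 by (metis even_add even_mult_iff dvd_triv_left)
        show "odd A" by fact
        show "3 * e \<le> (b - 2) + 2" using ab e by simp
        show "e \<le> s" using e ac(2) cA Ab(2) s by linarith
        have "A * b = A * (b - 2) + 2 * A" using h e by (simp add: algebra_simps)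
        then show "s \<le> A * (b - 2)" using s nA by linarith
      qed
      then obtain j where j: "j \<le> A" "odd j" "j * e \<le> s" "s \<le> j * (b - 2)" by blast
      have "even (s - j * e)"
        using j ac(3) e s bq(3) 3 by (metis even_add even_diff_nat even_mult_iff dvd_triv_left even_numeral)
      then obtain v where v: "s = j * e + 2 * v" using j(3) by (metis evenE le_add_diff_inverse)
      have "solvable n A B"
      proof (rule solvable_progression[of 2 B h a 2 b j n v])
        show "v \<le> j * h" using j(4) v h e by (simp add: algebra_simps)
        obtain w where "n = j + w" using j(1) nA le_Suc_ex[of j n] by auto
        then show "A * b = (n - j) * 2 + (j * a + 2 * v)" using s v e by (simp add: algebra_simps)
        show "b \<in> B" using mem[of h] h by simp
      qed (use mem B2 j nA in auto)
      then show False using free by simp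
    qed
  qed
qed

text \<open>
  By now 1, 3, 4 are red and 2 is blue. Since \<open>{1, 3, 4}\<close> has nearly all \<open>n\<close>-fold sums, \<open>c + 1, ..., q\<close>
  are blue with \<open>q = 3 n div A\<close>. Together with 2 they solve the equation for \<open>y = q\<close>.
\<close>
lemma contradiction: False
proof -
  define q where "q = 3 * n div A"
  have q: "A * q \<le> 3 * n" "3 * n < A * (q + 1)"
    using floor_multiple[of A "3 * n"] A2 unfolding q_def by auto
  have "A * (3 * c - 3) < A * (q + 1)"
    using c(1) q(2) by (simp add: algebra_simps)
  then have qc: "3 * c - 3 < q + 1" by (simp only: mult_less_cancel1)
  have cn: "c + A \<le> n" using c_le .
  have sub: "{c + 1..q} \<subseteq> B"
  proof
    fix y assume "y \<in> {c + 1..q}"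
    then have "A * (c + 1) \<le> A * y" "A * y \<le> A * q" by (intro mult_le_mono2; simp)+
    moreover have "A * (c + 1) = A * c + A" by simp
    ultimately have y: "n + 2 \<le> A * y" "A * y \<le> 3 * n"
      using n_le q(1) A2 by linarith+
    then have "y \<notin> R"
      using solvable_1_3_4_sums[of n A y R] R1 three_in_R four_in_R free by auto
    moreover have "y \<in> R \<or> y \<in> B"
      using mn_le[OF c3 y(2)] \<open>y \<in> {c + 1..q}\<close> by (intro cover) auto
    ultimately show "y \<in> B" by blast
  qed
  have "3 \<le> q" using qc c3 by linarith
  then have "n * 3 \<le> n * q" by (rule mult_le_mono2)
  then have upper: "A * q \<le> n * q" using q(1) by linarith
  have lower: "n * 2 + (c + 1 - 2) \<le> A * q" using q(2) cn c3 by (simp add: algebra_simps)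
  have "solvable n A B"
    by (rule solvable_interval[of 2 B "c + 1" q q]) (use two_in_B sub qc c3 upper lower in auto)
  then show False using free by simp
qed

end

lemma solvable_class_if_long:
  assumes "2 \<le> A" "2 * A < n" "(c - 1) * A < n" "n \<le> c * A" "n * c \<le> A * r"
  shows "\<exists>b. solvable n A (color_class r \<chi> b)"
proof (rule ccontr)
  assume no: "\<nexists>b. solvable n A (color_class r \<chi> b)"
  have "1 \<le> r"
  proof -
    have "c \<noteq> 0" using assms by (cases c) auto
    then have "n * c \<noteq> 0" using assms by simp
    then show ?thesis using assms(5) by (cases r) auto
  qed
  then interpret free_two_coloring n A c r "color_class r \<chi> (\<chi> 1)" "color_class r \<chi> (\<not> \<chi> 1)"
    using assms no by unfold_locales (auto simp: color_class_def)
  show False by (rule contradiction)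
qed

text \<open>
  Above the threshold the \<open>n\<close>-fold sums are at least \<open>n * c > A * r\<close>; below it the \<open>A\<close>-fold sums are at
  most \<open>A * (c - 1) < n\<close>.
\<close>
lemma threshold_coloring_free:
  assumes "(c - 1) * A < n" "A * r < n * c"
  shows "fold_sums n (color_class r (\<lambda>z. c \<le> z) b) \<inter> fold_sums A (color_class r (\<lambda>z. c \<le> z) b) = {}"
proof -
  let ?C = "color_class r (\<lambda>z. c \<le> z)"
  have False if s: "s \<in> fold_sums n (?C b)" "s \<in> fold_sums A (?C b)" for s
  proof (cases b)
    case True
    have "n * c \<le> s" using s(1) by (rule fold_sums_lower) (auto simp: color_class_def True)
    moreover have "s \<le> A * r" using s(2) by (rule fold_sums_upper) (auto simp: color_class_def)
    ultimately show False using assms(2) by simp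
  next
    case False
    have "n * 1 \<le> s" using s(1) by (rule fold_sums_lower) (auto simp: color_class_def)
    moreover have "s \<le> A * (c - 1)" using s(2)
      by (rule fold_sums_upper) (auto simp: color_class_def False)
    ultimately show False using assms(1) by (simp add: mult.commute)
  qed
  then show ?thesis by blast
qed

section \<open>Equality of the Rado numbers\<close>

lemma solvable_if_at_most_two:
  assumes "S \<subseteq> {u, u + d}" "1 \<le> n" "fold_sums n S \<inter> fold_sums A S \<noteq> {}"
  shows "solvable n A S"
proof -
  have "S \<noteq> {}"
    using assms(2,3) by (auto simp: fold_sums_def)
  then have "S = {u, u + d} \<or> S = {u, u + 0} \<or> S = {u + d, u + d + 0}"
    using assms(1) by auto
  then show ?thesis using solvable_two assms(3) by metis
qed

lemma all_colorings_mono_iff: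
  assumes "2 \<le> n" "1 \<le> length a" "\<forall>w\<in>set a. 0 < w" "A = sum_list a" "A \<le> 2 * n" "1 \<le> r"
    and exc: "(n, A) \<notin> {(2, 3), (2, 4), (3, 5), (5, 10), (6, 11), (7, 12), (8, 13), (9, 14)}"
  shows "(\<forall>\<chi>. has_mono_solution (replicate n 1) a r \<chi>) \<longleftrightarrow>
    (\<forall>\<chi>. has_mono_solution (replicate n 1) [A] r \<chi>)"
proof
  assume "\<forall>\<chi>. has_mono_solution (replicate n 1) [A] r \<chi>"
  then show "\<forall>\<chi>. has_mono_solution (replicate n 1) a r \<chi>"
    using has_mono_solution_single_iff has_mono_solutionI assms(4) by blast
next
  assume all: "\<forall>\<chi>. has_mono_solution (replicate n 1) a r \<chi>"
  show "\<forall>\<chi>. has_mono_solution (replicate n 1) [A] r \<chi>"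
  proof
    fix \<chi>
    obtain w ws where a: "a = w # ws" using assms(2) by (cases a) auto
    show "has_mono_solution (replicate n 1) [A] r \<chi>"
    proof (cases ws)
      case Nil
      then show ?thesis using all a assms(4) by simp
    next
      case (Cons v vs)
      then have A2: "2 \<le> A" using a assms(3,4) by auto
      consider "n = A" | "n \<noteq> A" "n \<le> 2 * A" | "2 * A < n" by linarith
      then have "\<exists>b. solvable n A (color_class r \<chi> b)"
      proof cases
        case 1
        have "1 \<in> color_class r \<chi> (\<chi> 1)" using assms(6) by (simp add: color_class_def)
        then have "solvable n A (color_class r \<chi> (\<chi> 1))"
          using fold_sums_replicate[of 1 _ n] 1 unfolding solvable_def by blast
        then show ?thesis by blast
      next
        case 2
        show ?thesis
        proof (rule ccontr)
          assume no: "\<nexists>b. solvable n A (color_class r \<chi> b)"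
          obtain b where b: "fold_sums n (color_class r \<chi> b) \<inter> fold_sums A (color_class r \<chi> b) \<noteq> {}"
            using has_mono_solutionD[of n a r \<chi>] all assms(4) by blast
          obtain u d where "color_class r \<chi> b \<subseteq> {u, u + d}"
            using at_most_two_per_class[OF assms(1) A2 2(2) assms(5) 2(1) exc, of r \<chi> b] no by blast
          then show False using solvable_if_at_most_two[OF _ _ b] assms(1) no by auto
        qed
      next
        case 3
        define c where "c = (n + A - 1) div A"
        have c: "n \<le> A * c" "A * c < n + A"
          using ceil_multiple[of A n] A2 by (auto simp: c_def)
        then have c': "(c - 1) * A < n" "n \<le> c * A" using 3
          by (auto simp: algebra_simps diff_mult_distrib)
        have "n * c \<le> A * r"
        proof (rule ccontr)
          assume "\<not> n * c \<le> A * r"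
          then show False
            using threshold_coloring_free[OF c'(1), of r] has_mono_solutionD[of n a r] all assms(4)
            by (metis not_le)
        qed
        then show ?thesis using solvable_class_if_long[OF A2 3 c'] by blast
      qed
      then show ?thesis by (simp only: has_mono_solution_single_iff)
    qed
  qed
qed

theorem theorem3:
  fixes n A :: nat and a :: "nat list"
  assumes "n \<ge> 2"
    and "length a \<ge> 1"
    and "\<forall>c \<in> set a. c > 0"
    and "A = sum_list a"
  shows "(n \<ge> A \<longrightarrow> rado_number2 (replicate n 1) a = R2 (n + 1) A) \<and>
    (2 * n \<ge> A \<and> A > n \<and>
      (n, A) \<notin> {(2, 3), (2, 4), (3, 5), (5, 10), (6, 11), (7, 12), (8, 13), (9, 14)} \<longrightarrow>
      rado_number2 (replicate n 1) a = R2 (n + 1) A)"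
proof -
  have eq: "rado_number2 (replicate n 1) a = R2 (n + 1) A"
    if "A \<le> 2 * n"
      "(n, A) \<notin> {(2, 3), (2, 4), (3, 5), (5, 10), (6, 11), (7, 12), (8, 13), (9, 14)}"
  proof -
    have "(\<lambda>r. 1 \<le> r \<and> (\<forall>\<chi>. has_mono_solution (replicate n 1) a r \<chi>)) =
      (\<lambda>r. 1 \<le> r \<and> (\<forall>\<chi>. has_mono_solution (replicate n 1) [A] r \<chi>))"
      by (intro ext conj_cong refl all_colorings_mono_iff[OF assms that(1) _ that(2)])
    then show ?thesis unfolding R2_def rado_number2_def by simp
  qed
  have "(n, A) \<notin> {(2, 3), (2, 4), (3, 5), (5, 10), (6, 11), (7, 12), (8, 13), (9, 14)}" if "A \<le> n"
  proof
    assume "(n, A) \<in> {(2, 3), (2, 4), (3, 5), (5, 10), (6, 11), (7, 12), (8, 13), (9, 14)}"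
    then have "n < A" by auto
    then show False using that by simp
  qed
  then show ?thesis
    by (intro conjI impI eq) simp_all
qed

end
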